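(* The following statements are true: (1) For all $d\in \operatorname{int}(\overline{D})$, there exists $d'\in \operatorname{int}(\overline{D})$ such that $P_{\mathrm{MTZ}}(d')\subsetneq P_{\mathrm{MTZ}}(d)$. (2) Let $C,C'\in\mathcal C_1$ with $|C|,|C'|\leq n-2$ and $C\neq C'$, and let $d,d'\in \overline{D}$ be in the relative interior of the facets of $\overline{D}$ defined by $C$ and $C'$ respectively, that is, of the facets $\{d\in\overline D:\sum_{ij\in C}d_{ij}=1\}$ and $\{d\in\overline D:\sum_{ij\in C'}d_{ij}=1\}$. Then $P_{\mathrm{MTZ}}(d')$ and $P_{\mathrm{MTZ}}(d)$ are not comparable, i.e. neither of them is contained in the other.
   Context: Let $n\ge 4$, $N=\{1,\dots,n\}$, $A=\{ij : i,j\in N,\ i\ne j\}$, $N_1=N\setminus\{1\}$, $A_1=\{ij : i,j\in N_1,\ i\neq j\}$. $\mathcal C_1$ is the set of (simple) directed cycles with arcs in $A_1$, each of length at least 2 and identified with its set of arcs; $|C|$ is the number of arcs. $P_{\mathrm{AP}}$ is the set of $x\in[0,1]^A$ with $\sum_{j\neq i}x_{ij}=1$ and $\sum_{j\ne i}x_{ji}=1$ for all $i\in N$. $\overline D=\{d\in\mathbb R_+^{A_1} : \sum_{ij\in C}d_{ij}\le 1\ \text{for all } C\in\mathcal C_1\}$ (with $\mathbb R_+$ the nonnegative reals), a full-dimensional polytope in $\mathbb R^{A_1}$, and $\operatorname{int}(\overline D)$ is its topological interior. For $d\in\overline D$, $P_{\mathrm{MTZ}}(d)$ is the projection onto the $x$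 variables of $$Q_{\mathrm{MTZ}}(d)=\{(x,u)\in P_{\mathrm{AP}}\times\mathbb R^{N_1} : u_i-u_j+d_{ij}\le 1-x_{ij}\ \text{for all } ij\in A_1\}.$$ *)

theory Defs
  imports "HOL-Analysis.Analysis"
begin

text \<open>
  The node set \<open>N\<close> is the universe of a finite type \<open>'n\<close> (so \<open>n\<close> is \<open>CARD('n)\<close>), and an arbitrary
  fixed node \<open>r\<close> plays the role of node 1. For a set \<open>E\<close> of indices, the space of real vectors
  indexed by \<open>E\<close> is represented by the vectors indexed by the whole type that vanish outside \<open>E\<close>.
\<close>

definition coord_space :: "'i set \<Rightarrow> (real ^ 'i::finite) set"
  where "coord_space E = {x. \<forall>i. i \<notin> E \<longrightarrow> x $ i = 0}"

definition nodes1 :: "'n \<Rightarrow> 'n set"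
  where "nodes1 r = UNIV - {r}"

definition arcs :: "('n \<times> 'n) set"
  where "arcs = {(i, j). i \<noteq> j}"

definition arcs1 :: "'n \<Rightarrow> ('n \<times> 'n) set"
  where "arcs1 r = {(i, j). i \<in> nodes1 r \<and> j \<in> nodes1 r \<and> i \<noteq> j}"

text \<open>The arc set of the closed walk visiting the nodes of the list in order and returning to the
  first one.\<close>

definition cycle_arcs :: "'n list \<Rightarrow> ('n \<times> 'n) set"
  where "cycle_arcs vs = set (zip vs (rotate1 vs))"

definition cycles1 :: "'n \<Rightarrow> ('n \<times> 'n) set set"
  where "cycles1 r = {cycle_arcs vs | vs. distinct vs \<and> 2 \<le> length vs \<and> set vs \<subseteq> nodes1 r}"

definition P_AP :: "(real ^ ('n::finite \<times> 'n)) set"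
  where "P_AP = {x \<in> coord_space arcs.
    (\<forall>a\<in>arcs. 0 \<le> x $ a \<and> x $ a \<le> 1) \<and>
    (\<forall>i. (\<Sum>j | j \<noteq> i. x $ (i, j)) = 1) \<and>
    (\<forall>i. (\<Sum>j | j \<noteq> i. x $ (j, i)) = 1)}"

definition Dbar :: "'n \<Rightarrow> (real ^ ('n::finite \<times> 'n)) set"
  where "Dbar r = {d \<in> coord_space (arcs1 r).
    (\<forall>a\<in>arcs1 r. 0 \<le> d $ a) \<and> (\<forall>C\<in>cycles1 r. (\<Sum>a\<in>C. d $ a) \<le> 1)}"

text \<open>The interior is taken in the space of vectors indexed by \<open>arcs1 r\<close>, not in the ambient type,
  where it would be empty.\<close>

definition int_Dbar :: "'n \<Rightarrow> (real ^ ('n::finite \<times> 'n)) set"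
  where "int_Dbar r = (top_of_set (coord_space (arcs1 r))) interior_of (Dbar r)"

definition cycle_facet :: "'n \<Rightarrow> ('n \<times> 'n) set \<Rightarrow> (real ^ ('n::finite \<times> 'n)) set"
  where "cycle_facet r C = {d \<in> Dbar r. (\<Sum>a\<in>C. d $ a) = 1}"

definition Q_MTZ ::
    "'n \<Rightarrow> real ^ ('n::finite \<times> 'n) \<Rightarrow> ((real ^ ('n \<times> 'n)) \<times> (real ^ 'n)) set"
  where "Q_MTZ r d = {(x, u). x \<in> P_AP \<and> u \<in> coord_space (nodes1 r) \<and>
    (\<forall>(i, j)\<in>arcs1 r. u $ i - u $ j + d $ (i, j) \<le> 1 - x $ (i, j))}"

definition P_MTZ :: "'n \<Rightarrow> real ^ ('n::finite \<times> 'n) \<Rightarrow> (real ^ ('n \<times> 'n)) set"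
  where "P_MTZ r d = fst ` Q_MTZ r d"

end

theory Submission imports Defs begin

text \<open>
  Eliminating \<open>u\<close> turns \<open>P_MTZ r d\<close> into a system of cycle inequalities: the constraints on \<open>u\<close>
  ask for a node potential with respect to the arc weights \<open>1 - x - d\<close>, and such a potential exists
  exactly when no cycle of \<open>cycles1 r\<close> has negative weight. Hence \<open>P_MTZ r d\<close> consists of the points
  of \<open>P_AP\<close> with \<open>x(C) \<le> \<bar>C\<bar> - d(C)\<close> for all \<open>C\<close>, where \<open>x(C)\<close> and \<open>d(C)\<close> are the sums over the
  arcs of \<open>C\<close> (\<open>P_MTZ_iff_cycle_inequalities\<close>).

  The key fact is that, for \<open>d\<close> in \<open>Dbar r\<close> and a cycle \<open>C\<close> with at most \<open>n - 2\<close> arcs, the right-hand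
  side of the inequality of \<open>C\<close> can be read off from \<open>P_MTZ r d\<close>: if \<open>P_MTZ r d \<subseteq> P_MTZ r d'\<close> then
  \<open>d'(C) \<le> d(C)\<close> (\<open>cycle_sum_le_if_P_MTZ_subset\<close>). For this one needs a point of \<open>P_MTZ r d\<close> where the
  inequality of \<open>C\<close> is tight. At least two nodes lie off \<open>C\<close>, so they carry a cycle through \<open>r\<close>;
  together with \<open>C\<close> it gives an assignment that contains \<open>C\<close> and no other cycle avoiding \<open>r\<close>. A
  Hamiltonian tour contains no cycle avoiding \<open>r\<close> at all. On the segment between the two
  assignments, \<open>x(K) \<le> \<bar>K\<bar> - 1 \<le> \<bar>K\<bar> - d(K)\<close> for every cycle \<open>K \<noteq> C\<close>, while \<open>x(C)\<close> falls from \<open>\<bar>C\<bar>\<close>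
  to at most \<open>\<bar>C\<bar> - 1\<close>, and so passes through \<open>\<bar>C\<bar> - d(C)\<close>.

  Both parts follow. From an interior point \<open>d\<close> one can increase all coordinates a little; this
  shrinks the projection, and strictly, since it increases \<open>d(C)\<close> for a cycle \<open>C\<close> of length 2. In the
  relative interior of the facet of \<open>C\<close> every other cycle inequality of \<open>Dbar r\<close> is strict, so
  \<open>d(C') < 1 = d'(C')\<close> and \<open>d'(C) < 1 = d(C)\<close>, which excludes both inclusions.
\<close>

section \<open>Arc sets of cycles\<close>

lemma inj_on_fst_cycle_arcs:
  assumes "distinct vs"
  shows "inj_on fst (cycle_arcs vs)"
proof (rule inj_onI)
  fix a b assume "a \<in> cycle_arcs vs" "b \<in> cycle_arcs vs" "fst a = fst b"
  then obtain k l where "k < length vs" "l < length vs"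
      "fst a = vs ! k" "fst b = vs ! l" "vs ! k = vs ! l"
      "snd a = rotate1 vs ! k" "snd b = rotate1 vs ! l"
    by (fastforce simp: cycle_arcs_def in_set_zip)
  moreover from this have "k = l"
    using assms by (simp add: nth_eq_iff_index_eq)
  ultimately show "a = b" by (simp add: prod_eq_iff)
qed

lemma inj_on_snd_cycle_arcs:
  assumes "distinct vs"
  shows "inj_on snd (cycle_arcs vs)"
proof (rule inj_onI)
  have "distinct (rotate1 vs)" using assms by simp
  fix a b assume "a \<in> cycle_arcs vs" "b \<in> cycle_arcs vs" "snd a = snd b"
  then obtain k l where "k < length vs" "l < length vs"
      "fst a = vs ! k" "fst b = vs ! l"
      "snd a = rotate1 vs ! k" "snd b = rotate1 vs ! l" "rotate1 vs ! k = rotate1 vs ! l"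
    by (fastforce simp: cycle_arcs_def in_set_zip)
  moreover from this have "k = l"
    using \<open>distinct (rotate1 vs)\<close> by (simp add: nth_eq_iff_index_eq)
  ultimately show "a = b" by (simp add: prod_eq_iff)
qed

lemma fst_cycle_arcs: "fst ` cycle_arcs vs = set vs"
  unfolding cycle_arcs_def by (metis length_rotate1 list.set_map map_fst_zip)

lemma snd_cycle_arcs: "snd ` cycle_arcs vs = set vs"
  unfolding cycle_arcs_def by (metis length_rotate1 list.set_map map_snd_zip set_rotate1)

lemma finite_cycle_arcs [simp]: "finite (cycle_arcs vs)"
  by (simp add: cycle_arcs_def)

lemma card_cycle_arcs:
  assumes "distinct vs"
  shows "card (cycle_arcs vs) = length vs"
  by (metis assms card_image distinct_card fst_cycle_arcs inj_on_fst_cycle_arcs)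

lemma cycle_arcs_subset_arcs:
  assumes "distinct vs" "2 \<le> length vs"
  shows "cycle_arcs vs \<subseteq> arcs"
proof
  fix a assume "a \<in> cycle_arcs vs"
  then obtain k where k: "k < length vs" "fst a = vs ! k" "snd a = vs ! (Suc k mod length vs)"
    by (auto simp: cycle_arcs_def in_set_zip nth_rotate1)
  have "Suc k mod length vs \<noteq> k"
    using k assms(2) by (cases "Suc k = length vs") auto
  moreover have "Suc k mod length vs < length vs" using k by (intro mod_less_divisor) auto
  ultimately have "fst a \<noteq> snd a"
    using k assms(1) by (simp add: nth_eq_iff_index_eq)
  then show "a \<in> arcs" by (auto simp: arcs_def split: prod.splits)
qed

lemma cycles1_subset_arcs1:
  assumes "C \<in> cycles1 r"
  shows "C \<subseteq> arcs1 r"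
proof -
  obtain vs where vs: "C = cycle_arcs vs" "distinct vs" "2 \<le> length vs" "set vs \<subseteq> nodes1 r"
    using assms by (auto simp: cycles1_def)
  show ?thesis
  proof
    fix a assume "a \<in> C"
    then have "fst a \<in> set vs" "snd a \<in> set vs" "a \<in> arcs"
      using vs fst_cycle_arcs[of vs] snd_cycle_arcs[of vs] cycle_arcs_subset_arcs[of vs] by auto
    then show "a \<in> arcs1 r" using vs(4) by (cases a) (auto simp: arcs1_def arcs_def)
  qed
qed

text \<open>Starting at a common node, walking along the cycle never leaves a set that is closed under
  its arcs, and the walk visits the whole cycle.\<close>

lemma cycle_nodes_subset_closed_set:
  assumes "v \<in> set vs" "v \<in> S"
    and closed: "\<And>i j. (i, j) \<in> cycle_arcs vs \<Longrightarrow> i \<in> S \<Longrightarrow> j \<in> S"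
  shows "set vs \<subseteq> S"
proof -
  let ?n = "length vs"
  have n: "0 < ?n" using assms(1) by (cases vs) auto
  obtain k where k: "k < ?n" "vs ! k = v" using assms(1) by (auto simp: in_set_conv_nth)
  have step: "vs ! (Suc m mod ?n) \<in> S" if "m < ?n" "vs ! m \<in> S" for m
  proof (rule closed[OF _ that(2)])
    show "(vs ! m, vs ! (Suc m mod ?n)) \<in> cycle_arcs vs"
      using that by (auto simp: cycle_arcs_def in_set_zip nth_rotate1)
  qed
  have walk: "vs ! ((k + m) mod ?n) \<in> S" for m
  proof (induction m)
    case 0 then show ?case using k assms(2) by simp
  next
    case (Suc m)
    have "(k + m) mod ?n < ?n" using n by simp
    from step[OF this Suc] show ?case by (simp add: mod_Suc_eq)
  qed
  show ?thesis
  proof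
    fix x assume "x \<in> set vs"
    then obtain l where l: "l < ?n" "vs ! l = x" by (auto simp: in_set_conv_nth)
    \<comment> \<open>From position \<open>k\<close>, position \<open>l\<close> is reached by going forward past the end of the list.\<close>
    have "(k + (?n - k + l)) mod ?n = l" using k l by simp
    then show "x \<in> S" using walk[of "?n - k + l"] l by simp
  qed
qed

text \<open>If each node has at most one outgoing arc in \<open>F\<close>, then a walk in \<open>F\<close> is determined by its first
  node. So two cycles in \<open>F\<close> cannot branch apart after a common node.\<close>

lemma cycle_nodes_subset_if_common_node:
  assumes F: "inj_on fst F" "cycle_arcs vs \<subseteq> F" "cycle_arcs zs \<subseteq> F"
    and v: "v \<in> set vs" "v \<in> set zs"
  shows "set vs \<subseteq> set zs"
proof (rule cycle_nodes_subset_closed_set[OF v])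
  fix i j assume ij: "(i, j) \<in> cycle_arcs vs" "i \<in> set zs"
  then obtain j' where j': "(i, j') \<in> cycle_arcs zs" using fst_cycle_arcs[of zs] by force
  then have "j' = j" using F ij by (auto dest!: inj_onD[of fst F "(i, j)" "(i, j')"])
  with j' show "j \<in> set zs" using snd_cycle_arcs[of zs] by force
qed

lemma cycle_arcs_subset_if_common_node:
  assumes F: "inj_on fst F" "cycle_arcs vs \<subseteq> F" "cycle_arcs zs \<subseteq> F"
    and v: "v \<in> set vs" "v \<in> set zs"
  shows "cycle_arcs vs \<subseteq> cycle_arcs zs"
proof
  fix a assume a: "a \<in> cycle_arcs vs"
  then have "fst a \<in> set zs"
    using cycle_nodes_subset_if_common_node[OF assms] fst_cycle_arcs[of vs] by auto
  then obtain b where b: "b \<in> cycle_arcs zs" "fst a = fst b"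
    using fst_cycle_arcs[of zs] by (metis imageE)
  then have "a = b" using F a by (meson inj_onD subsetD)
  with b show "a \<in> cycle_arcs zs" by simp
qed

lemma cycle_arcs_eq_if_common_node:
  assumes "inj_on fst F" "cycle_arcs vs \<subseteq> F" "cycle_arcs zs \<subseteq> F"
    and "v \<in> set vs" "v \<in> set zs"
  shows "cycle_arcs vs = cycle_arcs zs"
proof (rule subset_antisym)
  show "cycle_arcs vs \<subseteq> cycle_arcs zs"
    using assms by (rule cycle_arcs_subset_if_common_node)
  show "cycle_arcs zs \<subseteq> cycle_arcs vs"
    using assms(1,3,2,5,4) by (rule cycle_arcs_subset_if_common_node)
qed

text \<open>With the larger cycle in the role of \<open>F\<close>, the smaller one meets it and so is all of it.\<close>

lemma cycles1_eq_if_subset: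
  assumes "C \<in> cycles1 r" "C' \<in> cycles1 r" "C \<subseteq> C'"
  shows "C = C'"
proof -
  obtain vs where vs: "C = cycle_arcs vs" "2 \<le> length vs"
    using assms(1) by (auto simp: cycles1_def)
  obtain zs where zs: "C' = cycle_arcs zs" "distinct zs"
    using assms(2) by (auto simp: cycles1_def)
  obtain v where v: "v \<in> set vs" using vs(2) by (cases vs) auto
  then have "v \<in> set zs"
    using image_mono[OF assms(3), of fst] vs(1) zs(1) fst_cycle_arcs[of vs] fst_cycle_arcs[of zs]
    by auto
  with v show ?thesis
    using cycle_arcs_eq_if_common_node[of C' vs zs v] assms(3) vs(1) zs
      inj_on_fst_cycle_arcs[OF zs(2)] by simp
qed

section \<open>Node potentials\<close>

fun path_weight :: "('a \<times> 'a \<Rightarrow> real) \<Rightarrow> 'a list \<Rightarrow> real" where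
  "path_weight w (i # j # p) = w (i, j) + path_weight w (j # p)"
| "path_weight w p = 0"

lemma path_weight_append:
  "path_weight w (p @ i # q) = path_weight w (p @ [i]) + path_weight w (i # q)"
proof (induction p)
  case (Cons a p)
  then show ?case by (cases p) auto
qed simp

lemma path_weight_eq_sum_list:
  "path_weight w (i # p) = sum_list (map w (zip (i # p) p))"
  by (induction p arbitrary: i) auto

lemma path_weight_closed:
  assumes "distinct (i # p)"
  shows "path_weight w (i # p @ [i]) = sum w (cycle_arcs (i # p))"
proof -
  \<comment> \<open>The last node starts no arc of the path, and \<open>p @ [i]\<close> is \<open>rotate1 (i # p)\<close>.\<close>
  have "zip (i # p @ [i]) (p @ [i]) = zip (i # p) (p @ [i])"
    using zip_append1[of "i # p" "[i]" "p @ [i]"] by simp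
  moreover have "distinct (zip (i # p) (p @ [i]))"
    using assms by (intro distinct_zipI1) auto
  ultimately show ?thesis
    by (simp add: path_weight_eq_sum_list cycle_arcs_def sum_list_distinct_conv_sum_set
        del: zip_Cons_Cons zip_Cons)
qed

text \<open>The potential of \<open>i\<close> is the least weight of a simple path starting at \<open>i\<close>, with an arbitrary end
  node. If a best path \<open>p\<close> from \<open>j\<close> avoids \<open>i\<close>, it can be prolonged by the arc \<open>(i, j)\<close>. Otherwise the
  part of \<open>p\<close> up to \<open>i\<close> closes to a cycle with this arc, and this cycle has nonnegative weight, so
  the part of \<open>p\<close> from \<open>i\<close> on weighs at most \<open>w (i, j)\<close> plus the weight of \<open>p\<close>.\<close>

lemma potential_exists:
  fixes w :: "'a \<times> 'a \<Rightarrow> real"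
  assumes "finite V"
    and cycles: "\<And>vs. distinct vs \<Longrightarrow> 2 \<le> length vs \<Longrightarrow> set vs \<subseteq> V \<Longrightarrow> 0 \<le> sum w (cycle_arcs vs)"
  shows "\<exists>u. \<forall>i\<in>V. \<forall>j\<in>V. i \<noteq> j \<longrightarrow> u i - u j \<le> w (i, j)"
proof -
  define P where "P i = {p. distinct (i # p) \<and> set (i # p) \<subseteq> V}" for i
  define u where "u i = Min ((\<lambda>p. path_weight w (i # p)) ` P i)" for i
  have fin: "finite (P i)" for i
    by (rule finite_subset[OF _ finite_subset_distinct[OF \<open>finite V\<close>]]) (auto simp: P_def)
  have le: "u i \<le> path_weight w (i # p)" if "p \<in> P i" for i p
    unfolding u_def using fin that by (intro Min_le) auto
  have "u i \<le> w (i, j) + u j" if ij: "i \<in> V" "j \<in> V" "i \<noteq> j" for i j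
  proof -
    have "[] \<in> P j" using ij by (simp add: P_def)
    then have "u j \<in> (\<lambda>p. path_weight w (j # p)) ` P j"
      unfolding u_def using fin by (intro Min_in) auto
    then obtain p where p: "p \<in> P j" "u j = path_weight w (j # p)" by auto
    show ?thesis
    proof (cases "i \<in> set p")
      case False
      then have "j # p \<in> P i" using p ij by (auto simp: P_def)
      from le[OF this] show ?thesis using p by simp
    next
      case True
      then obtain q s where p_eq: "p = q @ i # s" by (auto simp: in_set_conv_decomp)
      have "path_weight w (j # p) = path_weight w (j # q @ [i]) + path_weight w (i # s)"
        using path_weight_append[of w "j # q" i s] p_eq by simp
      moreover have "u i \<le> path_weight w (i # s)"
        using p p_eq by (intro le) (auto simp: P_def)
      moreover have "0 \<le> sum w (cycle_arcs (i # j # q))"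
        using p p_eq ij by (intro cycles) (auto simp: P_def)
      moreover have "sum w (cycle_arcs (i # j # q)) = w (i, j) + path_weight w (j # q @ [i])"
        using path_weight_closed[of i "j # q" w] p p_eq ij by (auto simp: P_def)
      ultimately show ?thesis using p by linarith
    qed
  qed
  then have "\<forall>i\<in>V. \<forall>j\<in>V. i \<noteq> j \<longrightarrow> u i - u j \<le> w (i, j)" by fastforce
  then show ?thesis by blast
qed

section \<open>The projection in terms of cycle inequalities\<close>

lemma sum_potential_difference_cycle:
  fixes u :: "'a \<Rightarrow> real"
  assumes "distinct vs"
  shows "(\<Sum>a\<in>cycle_arcs vs. u (fst a) - u (snd a)) = 0"
proof -
  have "(\<Sum>a\<in>cycle_arcs vs. u (fst a)) = sum u (set vs)"
    using sum.reindex[OF inj_on_fst_cycle_arcs[OF assms], of u] by (simp add: fst_cycle_arcs)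
  moreover have "(\<Sum>a\<in>cycle_arcs vs. u (snd a)) = sum u (set vs)"
    using sum.reindex[OF inj_on_snd_cycle_arcs[OF assms], of u] by (simp add: snd_cycle_arcs)
  ultimately show ?thesis by (simp add: sum_subtractf)
qed

text \<open>Summing the constraints over a cycle cancels \<open>u\<close>, which gives the inequalities. Conversely, they
  say that the weights \<open>1 - x - d\<close> have no negative cycle, so that a potential exists.\<close>

lemma P_MTZ_iff_cycle_inequalities:
  fixes x d :: "real ^ ('n::finite \<times> 'n)"
  shows "x \<in> P_MTZ r d \<longleftrightarrow>
    x \<in> P_AP \<and> (\<forall>C\<in>cycles1 r. (\<Sum>a\<in>C. x $ a) \<le> card C - (\<Sum>a\<in>C. d $ a))"
    (is "_ \<longleftrightarrow> _ \<and> ?cycles")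
proof
  assume "x \<in> P_MTZ r d"
  then obtain u :: "real ^ 'n" where x: "x \<in> P_AP"
    and u: "\<forall>(i, j)\<in>arcs1 r. u $ i - u $ j + d $ (i, j) \<le> 1 - x $ (i, j)"
    by (auto simp: P_MTZ_def Q_MTZ_def)
  have "(\<Sum>a\<in>C. x $ a) \<le> card C - (\<Sum>a\<in>C. d $ a)" if C: "C \<in> cycles1 r" for C
  proof -
    have "(\<Sum>a\<in>C. u $ fst a - u $ snd a) = 0"
      using C sum_potential_difference_cycle[of _ "\<lambda>i. u $ i"] by (auto simp: cycles1_def)
    moreover have "(\<Sum>a\<in>C. u $ fst a - u $ snd a) \<le> (\<Sum>a\<in>C. 1 - x $ a - d $ a)"
      using u cycles1_subset_arcs1[OF C] by (intro sum_mono) fastforce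
    ultimately show ?thesis by (simp add: sum_subtractf)
  qed
  with x show "x \<in> P_AP \<and> ?cycles" by blast
next
  assume x: "x \<in> P_AP \<and> ?cycles"
  have "\<exists>u. \<forall>i\<in>nodes1 r. \<forall>j\<in>nodes1 r. i \<noteq> j \<longrightarrow>
      u i - u j \<le> (\<lambda>a. 1 - x $ a - d $ a) (i, j)"
  proof (rule potential_exists)
    fix vs assume vs: "distinct vs" "2 \<le> length vs" "set vs \<subseteq> nodes1 r"
    then have "cycle_arcs vs \<in> cycles1 r" by (auto simp: cycles1_def)
    then show "0 \<le> (\<Sum>a\<in>cycle_arcs vs. 1 - x $ a - d $ a)"
      using x by (fastforce simp: sum_subtractf)
  qed simp
  then obtain u where u:
    "\<forall>i\<in>nodes1 r. \<forall>j\<in>nodes1 r. i \<noteq> j \<longrightarrow> u i - u j \<le> 1 - x $ (i, j) - d $ (i, j)"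
    by auto
  define u' :: "real ^ 'n" where "u' = (\<chi> i. if i \<in> nodes1 r then u i else 0)"
  have "(x, u') \<in> Q_MTZ r d"
    using x u by (fastforce simp: Q_MTZ_def u'_def coord_space_def arcs1_def)
  then show "x \<in> P_MTZ r d" unfolding P_MTZ_def by force
qed

lemma P_MTZ_antimono:
  assumes "\<And>a. d $ a \<le> d' $ a"
  shows "P_MTZ r d' \<subseteq> P_MTZ r d"
proof
  fix x assume x: "x \<in> P_MTZ r d'"
  have "(\<Sum>a\<in>C. d $ a) \<le> (\<Sum>a\<in>C. d' $ a)" for C by (intro sum_mono assms)
  then show "x \<in> P_MTZ r d"
    using x unfolding P_MTZ_iff_cycle_inequalities by (smt (verit))
qed

section \<open>Points violating a single cycle inequality\<close>

definition arc_indicator :: "('n \<times> 'n) set \<Rightarrow> real ^ ('n::finite \<times> 'n)"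
  where "arc_indicator F = (\<chi> a. indicator F a)"

lemma sum_arc_indicator:
  "(\<Sum>a\<in>C. arc_indicator F $ a) = card (C \<inter> F)"
  by (simp add: arc_indicator_def indicator_def sum.If_cases Int_def)

lemma sum_arc_indicator_le:
  fixes C :: "('n::finite \<times> 'n) set"
  assumes "\<not> C \<subseteq> F"
  shows "(\<Sum>a\<in>C. arc_indicator F $ a) \<le> real (card C) - 1"
proof -
  have "card (C \<inter> F) < card C" using assms by (intro psubset_card_mono) auto
  then show ?thesis by (simp add: sum_arc_indicator)
qed

lemma arc_indicator_in_P_AP:
  fixes F :: "('n::finite \<times> 'n) set"
  assumes "F \<subseteq> arcs" "inj_on fst F" "fst ` F = UNIV" "inj_on snd F" "snd ` F = UNIV"
  shows "arc_indicator F \<in> P_AP"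
proof -
  have out: "(\<Sum>j | j \<noteq> i. arc_indicator F $ (i, j)) = 1" for i
  proof -
    obtain j where j: "(i, j) \<in> F" using assms(3) by (metis UNIV_I imageE prod.collapse)
    moreover have "j' = j" if "(i, j') \<in> F" for j'
      using inj_onD[OF assms(2) _ that j] by simp
    moreover have "j \<noteq> i" using j assms(1) by (auto simp: arcs_def)
    ultimately have "{j'. j' \<noteq> i} \<inter> {j'. (i, j') \<in> F} = {j}" by blast
    then show ?thesis by (simp add: arc_indicator_def indicator_def sum.If_cases)
  qed
  have inn: "(\<Sum>j | j \<noteq> i. arc_indicator F $ (j, i)) = 1" for i
  proof -
    obtain j where j: "(j, i) \<in> F" using assms(5) by (metis UNIV_I imageE prod.collapse)
    moreover have "j' = j" if "(j', i) \<in> F" for j'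
      using inj_onD[OF assms(4) _ that j] by simp
    moreover have "j \<noteq> i" using j assms(1) by (auto simp: arcs_def)
    ultimately have "{j'. j' \<noteq> i} \<inter> {j'. (j', i) \<in> F} = {j}" by blast
    then show ?thesis by (simp add: arc_indicator_def indicator_def sum.If_cases)
  qed
  show ?thesis
    unfolding P_AP_def
    using assms(1) out inn by (auto simp: coord_space_def arc_indicator_def indicator_def)
qed

lemma convex_P_AP: "convex (P_AP :: (real ^ ('n::finite \<times> 'n)) set)"
proof (rule convexI)
  fix x y :: "real ^ ('n \<times> 'n)" and s t :: real
  assume x: "x \<in> P_AP" and y: "y \<in> P_AP" and st: "0 \<le> s" "0 \<le> t" "s + t = 1"
  have "s * p + t * q \<le> 1" if "p \<le> 1" "q \<le> 1" for p q :: real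
    using convex_bound_le[OF that st] by simp
  then show "s *\<^sub>R x + t *\<^sub>R y \<in> P_AP"
    using x y st unfolding P_AP_def coord_space_def
    by (auto simp: sum.distrib sum_distrib_left[symmetric])
qed

text \<open>The assignment \<open>F\<close> is \<open>C\<close> plus a cycle through all nodes off \<open>C\<close>, and \<open>G\<close> is a tour. The bound on
  \<open>card C\<close> leaves at least two nodes off \<open>C\<close>, since a cycle on a single node would be a loop. A cycle
  avoiding \<open>r\<close> in \<open>F\<close> or \<open>G\<close> must coincide with the component it meets, so that component is not
  the one through \<open>r\<close>.\<close>

lemma isolating_assignments:
  fixes r :: "'n::finite"
  assumes C: "C \<in> cycles1 r" "card C \<le> CARD('n) - 2"
  obtains F G :: "('n \<times> 'n) set"
  where "arc_indicator F \<in> P_AP" "C \<subseteq> F" "\<And>K. K \<in> cycles1 r \<Longrightarrow> K \<subseteq> F \<Longrightarrow> K = C"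
    and "arc_indicator G \<in> P_AP" "\<And>K. K \<in> cycles1 r \<Longrightarrow> \<not> K \<subseteq> G"
proof -
  obtain vs where vs: "C = cycle_arcs vs" "distinct vs" "2 \<le> length vs" "set vs \<subseteq> nodes1 r"
    using C(1) by (auto simp: cycles1_def)
  obtain ws where ws: "set ws = UNIV - set vs" "distinct ws"
    using finite_distinct_list[of "UNIV - set vs"] by auto
  have "length ws = CARD('n) - length vs"
    using ws vs(2) by (metis card_Diff_subset distinct_card finite_set top_greatest)
  moreover have "length vs \<le> CARD('n) - 2" using C(2) vs by (simp add: card_cycle_arcs)
  ultimately have len: "2 \<le> length ws" using vs(3) by linarith
  have r: "r \<notin> set vs" "r \<in> set ws" using vs(4) ws by (auto simp: nodes1_def)
  define F where "F = cycle_arcs vs \<union> cycle_arcs ws"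
  define G where "G = cycle_arcs (vs @ ws)"
  have inj_fst: "inj_on fst F"
    unfolding F_def inj_on_Un
    using inj_on_fst_cycle_arcs vs ws fst_cycle_arcs[of vs] fst_cycle_arcs[of ws] by blast
  have inj_snd: "inj_on snd F"
    unfolding F_def inj_on_Un
    using inj_on_snd_cycle_arcs vs ws snd_cycle_arcs[of vs] snd_cycle_arcs[of ws] by blast
  have dist: "distinct (vs @ ws)" and all: "set (vs @ ws) = UNIV" using vs ws by auto
  show thesis
  proof (rule that)
    show "arc_indicator F \<in> P_AP"
    proof (rule arc_indicator_in_P_AP)
      show "F \<subseteq> arcs"
        using vs ws len cycle_arcs_subset_arcs[of vs] cycle_arcs_subset_arcs[of ws]
        by (simp add: F_def)
    qed (use inj_fst inj_snd ws in \<open>auto simp: F_def image_Un fst_cycle_arcs snd_cycle_arcs\<close>)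
    show "C \<subseteq> F" by (simp add: F_def vs)
    show "arc_indicator G \<in> P_AP"
      using inj_on_fst_cycle_arcs[OF dist] inj_on_snd_cycle_arcs[OF dist] all vs(3)
        cycle_arcs_subset_arcs[OF dist]
      unfolding G_def
      by (intro arc_indicator_in_P_AP) (simp_all add: fst_cycle_arcs snd_cycle_arcs)
  next
    fix K assume K: "K \<in> cycles1 r" "K \<subseteq> F"
    obtain zs where zs: "K = cycle_arcs zs" "2 \<le> length zs" "set zs \<subseteq> nodes1 r"
      using K(1) by (auto simp: cycles1_def)
    obtain v where v: "v \<in> set zs" using zs(2) by (cases zs) auto
    have "v \<notin> set ws"
    proof
      assume "v \<in> set ws"
      then have "set ws \<subseteq> set zs"
        using cycle_nodes_subset_if_common_node[OF inj_fst, of ws zs v] v K(2) zs(1)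
        by (auto simp: F_def)
      then show False using r zs(3) by (auto simp: nodes1_def)
    qed
    then have "v \<in> set vs" using ws by auto
    then show "K = C"
      using cycle_arcs_eq_if_common_node[OF inj_fst, of zs vs v] v K(2) zs(1) vs(1)
      by (auto simp: F_def)
  next
    fix K assume K: "K \<in> cycles1 r"
    show "\<not> K \<subseteq> G"
    proof
      assume "K \<subseteq> G"
      obtain zs where zs: "K = cycle_arcs zs" "2 \<le> length zs" "set zs \<subseteq> nodes1 r"
        using K by (auto simp: cycles1_def)
      obtain v where v: "v \<in> set zs" using zs(2) by (cases zs) auto
      have "set (vs @ ws) \<subseteq> set zs"
        using cycle_nodes_subset_if_common_node[of G "vs @ ws" zs v] v \<open>K \<subseteq> G\<close> zs(1) all
          inj_on_fst_cycle_arcs[OF dist] by (auto simp: G_def)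
      then show False using all zs(3) by (auto simp: nodes1_def)
    qed
  qed
qed

text \<open>The point \<open>x\<close> on the segment between the assignments \<open>F\<close> and \<open>G\<close> satisfies the inequality of \<open>C\<close>
  with equality and all others because \<open>d(K) \<le> 1\<close>. It lies in \<open>P_MTZ r d\<close>, hence in \<open>P_MTZ r d'\<close>,
  whose inequality for \<open>C\<close> at \<open>x\<close> is the claim.\<close>

lemma cycle_sum_le_if_P_MTZ_subset:
  fixes r :: "'n::finite"
  assumes C: "C \<in> cycles1 r" "card C \<le> CARD('n) - 2"
    and d: "d \<in> Dbar r" and sub: "P_MTZ r d \<subseteq> P_MTZ r d'"
  shows "(\<Sum>a\<in>C. d' $ a) \<le> (\<Sum>a\<in>C. d $ a)"
proof -
  obtain F G where F: "arc_indicator F \<in> P_AP" "C \<subseteq> F"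
      "\<And>K. K \<in> cycles1 r \<Longrightarrow> K \<subseteq> F \<Longrightarrow> K = C"
    and G: "arc_indicator G \<in> P_AP" "\<And>K. K \<in> cycles1 r \<Longrightarrow> \<not> K \<subseteq> G"
    using isolating_assignments[OF C] by metis
  have dC: "0 \<le> (\<Sum>a\<in>C. d $ a)" "(\<Sum>a\<in>C. d $ a) \<le> 1"
    using d C(1) cycles1_subset_arcs1[OF C(1)] by (auto simp: Dbar_def intro!: sum_nonneg)
  define gap where "gap = card C - (\<Sum>a\<in>C. arc_indicator G $ a)"
  have gap: "1 \<le> gap"
    using sum_arc_indicator_le[OF G(2)[OF C(1)]] by (simp add: gap_def)
  \<comment> \<open>Along the segment the sum over \<open>C\<close> drops by \<open>gap\<close>, and it has to drop by \<open>d(C)\<close>.\<close>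
  define t where "t = (\<Sum>a\<in>C. d $ a) / gap"
  have t: "0 \<le> t" "t \<le> 1" "t * gap = (\<Sum>a\<in>C. d $ a)"
    using dC gap by (auto simp: t_def)
  define x where "x = (1 - t) *\<^sub>R arc_indicator F + t *\<^sub>R arc_indicator G"
  have x_sum: "(\<Sum>a\<in>K. x $ a) =
      (1 - t) * (\<Sum>a\<in>K. arc_indicator F $ a) + t * (\<Sum>a\<in>K. arc_indicator G $ a)" for K
    by (simp add: x_def sum.distrib sum_distrib_left)
  have "(\<Sum>a\<in>C. arc_indicator F $ a) = card C"
    using F(2) by (simp add: sum_arc_indicator Int_absorb2)
  moreover have "(\<Sum>a\<in>C. arc_indicator G $ a) = card C - gap" by (simp add: gap_def)
  ultimately have "(\<Sum>a\<in>C. x $ a) = (1 - t) * card C + t * (card C - gap)"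
    by (simp only: x_sum)
  also have "\<dots> = card C - t * gap" by (simp add: algebra_simps)
  finally have x_C: "(\<Sum>a\<in>C. x $ a) = card C - (\<Sum>a\<in>C. d $ a)" using t(3) by simp
  have "x \<in> P_AP" using convex_P_AP F(1) G(1) t by (auto simp: x_def convex_alt)
  moreover have "(\<Sum>a\<in>K. x $ a) \<le> card K - (\<Sum>a\<in>K. d $ a)" if K: "K \<in> cycles1 r" for K
  proof (cases "K = C")
    case True then show ?thesis using x_C by simp
  next
    case False
    then have "(\<Sum>a\<in>K. x $ a) \<le> real (card K) - 1"
      using F(3) G(2) K t sum_arc_indicator_le[of K F] sum_arc_indicator_le[of K G]
      unfolding x_sum by (intro convex_bound_le) auto
    moreover have "(\<Sum>a\<in>K. d $ a) \<le> 1" using d K by (simp add: Dbar_def)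
    ultimately show ?thesis by linarith
  qed
  ultimately have "x \<in> P_MTZ r d" by (simp add: P_MTZ_iff_cycle_inequalities)
  then have "x \<in> P_MTZ r d'" using sub by blast
  then show ?thesis using C(1) x_C by (fastforce simp: P_MTZ_iff_cycle_inequalities)
qed

section \<open>The polytope of parameters\<close>

lemma int_Dbar_subset_Dbar: "int_Dbar r \<subseteq> Dbar r"
  unfolding int_Dbar_def by (rule interior_of_subset)

lemma int_Dbar_translate:
  fixes d v :: "real ^ ('n::finite \<times> 'n)"
  assumes d: "d \<in> int_Dbar r" and v: "v \<in> coord_space (arcs1 r)"
  obtains e where "e > 0" "d + e *\<^sub>R v \<in> int_Dbar r"
proof -
  have "openin (top_of_set (coord_space (arcs1 r))) (int_Dbar r)"
    unfolding int_Dbar_def by (rule openin_interior_of)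
  then obtain b where b: "b > 0"
    "\<And>y. y \<in> coord_space (arcs1 r) \<Longrightarrow> dist y d < b \<Longrightarrow> y \<in> int_Dbar r"
    using d by (auto simp: openin_euclidean_subtopology_iff)
  \<comment> \<open>Adding 1 avoids a division by zero for \<open>v = 0\<close> and makes the distance smaller than \<open>b\<close>.\<close>
  define e where "e = b / (norm v + 1)"
  have n: "0 < norm v + 1" by (simp add: add_nonneg_pos)
  then have e: "e > 0" using b by (simp add: e_def)
  have "e * norm v < e * (norm v + 1)" using e by simp
  also have "\<dots> = b" using n by (simp add: e_def)
  finally have "dist (d + e *\<^sub>R v) d < b" using e by (simp add: dist_norm)
  moreover have "d + e *\<^sub>R v \<in> coord_space (arcs1 r)"
    using d v int_Dbar_subset_Dbar[of r] by (auto simp: coord_space_def Dbar_def)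
  ultimately show thesis using that e b(2) by blast
qed

lemma convex_cycle_facet: "convex (cycle_facet r C)"
proof (rule convexI)
  fix x y and s t :: real
  assume x: "x \<in> cycle_facet r C" and y: "y \<in> cycle_facet r C"
    and st: "0 \<le> s" "0 \<le> t" "s + t = 1"
  have sums: "(\<Sum>a\<in>K. (s *\<^sub>R x + t *\<^sub>R y) $ a) = s * (\<Sum>a\<in>K. x $ a) + t * (\<Sum>a\<in>K. y $ a)" for K
    by (simp add: sum.distrib sum_distrib_left)
  have "s * p + t * q \<le> 1" if "p \<le> 1" "q \<le> 1" for p q :: real
    using convex_bound_le[OF that st] by simp
  then show "s *\<^sub>R x + t *\<^sub>R y \<in> cycle_facet r C"
    using x y st unfolding cycle_facet_def Dbar_def mem_Collect_eq sums
    by (auto simp: coord_space_def)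
qed

text \<open>Spreading the value 1 evenly over the arcs of \<open>C\<close> gives a point \<open>y\<close> of the facet where the
  inequality of \<open>C'\<close> is strict, as \<open>C\<close> is not contained in \<open>C'\<close>. From a relative interior point \<open>d\<close>
  one can move on a little in the direction away from \<open>y\<close> within the facet, which would
  violate the inequality of \<open>C'\<close> if it were tight at \<open>d\<close>.\<close>

lemma rel_interior_cycle_facet_sum_less:
  assumes C: "C \<in> cycles1 r" "C' \<in> cycles1 r" "C \<noteq> C'"
    and d: "d \<in> rel_interior (cycle_facet r C)"
  shows "(\<Sum>a\<in>C'. d $ a) < 1"
proof -
  define y where "y = (1 / card C) *\<^sub>R arc_indicator C"
  have C_pos: "card C > 0" using C(1) by (auto simp: cycles1_def card_cycle_arcs)
  have y_sum: "(\<Sum>a\<in>K. y $ a) = card (K \<inter> C) / card C" for K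
    by (simp add: y_def sum_divide_distrib[symmetric] sum_arc_indicator)
  have "card (K \<inter> C) \<le> card C" for K by (intro card_mono) auto
  then have "(\<Sum>a\<in>K. y $ a) \<le> 1" for K using C_pos by (simp only: y_sum) simp
  moreover have "y \<in> coord_space (arcs1 r)" "0 \<le> y $ a" for a
    using cycles1_subset_arcs1[OF C(1)]
    by (auto simp: coord_space_def y_def arc_indicator_def indicator_def)
  moreover have "(\<Sum>a\<in>C. y $ a) = 1" using C_pos by (simp only: y_sum) (simp add: card_gt_0_iff)
  ultimately have "y \<in> cycle_facet r C" by (simp add: cycle_facet_def Dbar_def)
  then obtain e where e: "e > 1" "(1 - e) *\<^sub>R y + e *\<^sub>R d \<in> cycle_facet r C"
    using d convex_rel_interior_iff[OF convex_cycle_facet] by blast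
  have "(\<Sum>a\<in>C'. ((1 - e) *\<^sub>R y + e *\<^sub>R d) $ a) \<le> 1"
    using e(2) C(2) unfolding cycle_facet_def Dbar_def by blast
  then have le: "(1 - e) * (\<Sum>a\<in>C'. y $ a) + e * (\<Sum>a\<in>C'. d $ a) \<le> 1"
    by (simp add: sum.distrib sum_distrib_left)
  have "\<not> C \<subseteq> C'" using cycles1_eq_if_subset[OF C(1,2)] C(3) by auto
  then have "card (C' \<inter> C) < card C" by (intro psubset_card_mono) auto
  then have "(\<Sum>a\<in>C'. y $ a) < 1" using C_pos by (simp add: y_sum)
  then have "(1 - e) * 1 < (1 - e) * (\<Sum>a\<in>C'. y $ a)"
    using e(1) by (intro mult_strict_left_mono_neg) auto
  then have "(1 - e) * 1 + e * (\<Sum>a\<in>C'. d $ a) < 1"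
    by (rule less_le_trans[OF add_strict_right_mono le])
  then have "e * (\<Sum>a\<in>C'. d $ a) < e * 1" by simp
  then show ?thesis using e(1) by simp
qed

lemma not_P_MTZ_subset_if_rel_interior_cycle_facet:
  fixes r :: "'n::finite"
  assumes C: "C \<in> cycles1 r" "C' \<in> cycles1 r" "C \<noteq> C'" "card C' \<le> CARD('n) - 2"
    and d: "d \<in> rel_interior (cycle_facet r C)" and d': "d' \<in> cycle_facet r C'"
  shows "\<not> P_MTZ r d \<subseteq> P_MTZ r d'"
proof
  assume "P_MTZ r d \<subseteq> P_MTZ r d'"
  moreover have "d \<in> Dbar r" using d rel_interior_subset by (fastforce simp: cycle_facet_def)
  ultimately have "(\<Sum>a\<in>C'. d' $ a) \<le> (\<Sum>a\<in>C'. d $ a)"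
    using cycle_sum_le_if_P_MTZ_subset C by blast
  moreover have "(\<Sum>a\<in>C'. d $ a) < 1" using rel_interior_cycle_facet_sum_less C d by blast
  ultimately show False using d' by (simp add: cycle_facet_def)
qed

lemma smaller_P_MTZ_in_int_Dbar:
  fixes r :: "'n::finite"
  assumes n: "CARD('n) \<ge> 4" and d: "d \<in> int_Dbar r"
  shows "\<exists>d'\<in>int_Dbar r. P_MTZ r d' \<subset> P_MTZ r d"
proof -
  have "card (nodes1 r) \<ge> 2" using n by (simp add: nodes1_def)
  then obtain S where "S \<subseteq> nodes1 r" "card S = 2" by (rule obtain_subset_with_card_n)
  then obtain i j where ij: "i \<in> nodes1 r" "j \<in> nodes1 r" "i \<noteq> j" by (auto simp: card_2_iff)
  define C where "C = cycle_arcs [i, j]"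
  have C: "C \<in> cycles1 r" "card C = 2"
    using ij card_cycle_arcs[of "[i, j]"] unfolding C_def cycles1_def
    by (auto intro!: exI[of _ "[i, j]"])
  obtain e where e: "e > 0" "d + e *\<^sub>R arc_indicator (arcs1 r) \<in> int_Dbar r"
    by (rule int_Dbar_translate[OF d, of "arc_indicator (arcs1 r)"])
      (auto simp: coord_space_def arc_indicator_def)
  define d' where "d' = d + e *\<^sub>R arc_indicator (arcs1 r)"
  have "P_MTZ r d' \<subseteq> P_MTZ r d"
    using e(1) by (intro P_MTZ_antimono) (simp add: d'_def arc_indicator_def)
  moreover have "\<not> P_MTZ r d \<subseteq> P_MTZ r d'"
  proof
    assume "P_MTZ r d \<subseteq> P_MTZ r d'"
    then have "(\<Sum>a\<in>C. d' $ a) \<le> (\<Sum>a\<in>C. d $ a)"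
      using cycle_sum_le_if_P_MTZ_subset[OF C(1)] C(2) n d int_Dbar_subset_Dbar[of r] by auto
    moreover have "(\<Sum>a\<in>C. d' $ a) = (\<Sum>a\<in>C. d $ a) + e * (\<Sum>a\<in>C. arc_indicator (arcs1 r) $ a)"
      by (simp add: d'_def sum.distrib sum_distrib_left)
    moreover have "(\<Sum>a\<in>C. arc_indicator (arcs1 r) $ a) = 2"
      using C cycles1_subset_arcs1[OF C(1)] by (simp add: sum_arc_indicator Int_absorb2)
    ultimately show False using e(1) by simp
  qed
  ultimately show ?thesis using e(2) by (auto simp: d'_def)
qed

theorem proposition14:
  fixes r :: "'n::finite"
  assumes "CARD('n) \<ge> 4"
  shows "(\<forall>d \<in> int_Dbar r. \<exists>d' \<in> int_Dbar r. P_MTZ r d' \<subset> P_MTZ r d) \<and>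
    (\<forall>C \<in> cycles1 r. \<forall>C' \<in> cycles1 r.
      card C \<le> CARD('n) - 2 \<longrightarrow> card C' \<le> CARD('n) - 2 \<longrightarrow> C \<noteq> C' \<longrightarrow>
      (\<forall>d \<in> rel_interior (cycle_facet r C). \<forall>d' \<in> rel_interior (cycle_facet r C').
        \<not> P_MTZ r d' \<subseteq> P_MTZ r d \<and> \<not> P_MTZ r d \<subseteq> P_MTZ r d'))"
proof (intro conjI ballI impI)
  show "\<exists>d'\<in>int_Dbar r. P_MTZ r d' \<subset> P_MTZ r d" if "d \<in> int_Dbar r" for d
    using smaller_P_MTZ_in_int_Dbar[OF assms that] .
next
  fix C C' :: "('n \<times> 'n) set" and d d'
  assume C: "C \<in> cycles1 r" "C' \<in> cycles1 r" "C \<noteq> C'"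
      "card C \<le> CARD('n) - 2" "card C' \<le> CARD('n) - 2"
    and d: "d \<in> rel_interior (cycle_facet r C)" and d': "d' \<in> rel_interior (cycle_facet r C')"
  have facets: "d \<in> cycle_facet r C" "d' \<in> cycle_facet r C'"
    using d d' rel_interior_subset by blast+
  show "\<not> P_MTZ r d' \<subseteq> P_MTZ r d"
    by (rule not_P_MTZ_subset_if_rel_interior_cycle_facet[OF C(2,1) C(3)[symmetric] C(4) d' facets(1)])
  show "\<not> P_MTZ r d \<subseteq> P_MTZ r d'"
    by (rule not_P_MTZ_subset_if_rel_interior_cycle_facet[OF C(1-3,5) d facets(2)])
qed

end
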